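(* Let $B$ be a finite skew left brace such that $B\neq\mathrm{Ann}(B)$, and let $p$ be a prime with $\mathrm{Pb}(B)=\frac{2p-1}{p^2}$. Then $p$ divides $|B|$. Moreover, if $p$ is the smallest prime dividing $|B|$, then $B/\mathrm{Ann}(B)\cong\mathbb{Z}_p$, where $\mathbb{Z}_p$ denotes the unique skew brace of order $p$ (the trivial brace on the cyclic group of order $p$, in which $\circ=+$).
   Context: A skew left brace is a set $B$ with two group structures $(B,+)$ and $(B,\circ)$ (neither assumed abelian) such that $a\circ(b+c)=(a\circ b)-a+(a\circ c)$ for all $a,b,c\in B$, where $-a$ is the inverse of $a$ in $(B,+)$. The identities of the two groups coincide and are denoted by $1$. Put $a*b:=-a+(a\circ b)-b$ and $[a,b]^+:=a+b-a-b$. The annihilator of $B$ is $\mathrm{Ann}(B):=\{a\in B\mid a+b=b+a=a\circ b=b\circ a \text{ for all } b\in B\}$; it is an ideal of $B$, so $B/\mathrm{Ann}(B)$ is a quotient skew brace. Isomorphisms of skew braces are bijections that are homomorphisms for both $+$ and $\circ$. For a finite skew left brace $B$, the commuting probability is $$\mathrm{Pb}(B):=\frac{1}{|B|^2}\,\bigl|\{(a,b)\in B\times B \mid a*b=b*a=[a,b]^+=1\}\bigr|.$$ *)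

theory Defs
  imports Complex_Main "HOL-Algebra.Elementary_Groups" "HOL-Algebra.Ring" "HOL-Computational_Algebra.Primes"
begin

text \<open>
  Only the signature of the record \<open>ring\<close> is used: \<open>\<oplus>\<close> is the operation + of the skew brace and
  \<open>\<otimes>\<close> is the operation \<open>\<circ>\<close>. No ring axiom is assumed, and \<open>\<oplus>\<close> need not be commutative, so the
  order of the summands matters. The equality \<open>\<zero> = \<one>\<close> follows from the axioms
  (lemma \<open>zero_eq_one\<close>).
\<close>

locale skew_left_brace =
  fixes B (structure)
  assumes add_group: "group (add_monoid B)"
    and mult_group: "group B"
    and skew_distrib: "\<lbrakk>a \<in> carrier B; b \<in> carrier B; c \<in> carrier B\<rbrakk>
      \<Longrightarrow> a \<otimes> (b \<oplus> c) = ((a \<otimes> b) \<ominus> a) \<oplus> (a \<otimes> c)"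

definition star :: "('a, 'm) ring_scheme \<Rightarrow> 'a \<Rightarrow> 'a \<Rightarrow> 'a" where
  "star B a b = ((\<ominus>\<^bsub>B\<^esub> a) \<oplus>\<^bsub>B\<^esub> (a \<otimes>\<^bsub>B\<^esub> b)) \<ominus>\<^bsub>B\<^esub> b"

definition add_commutator :: "('a, 'm) ring_scheme \<Rightarrow> 'a \<Rightarrow> 'a \<Rightarrow> 'a" where
  "add_commutator B a b = ((a \<oplus>\<^bsub>B\<^esub> b) \<ominus>\<^bsub>B\<^esub> a) \<ominus>\<^bsub>B\<^esub> b"

definition Ann :: "('a, 'm) ring_scheme \<Rightarrow> 'a set" where
  "Ann B = {a \<in> carrier B. \<forall>b \<in> carrier B.
     a \<oplus>\<^bsub>B\<^esub> b = b \<oplus>\<^bsub>B\<^esub> a \<and> b \<oplus>\<^bsub>B\<^esub> a = a \<otimes>\<^bsub>B\<^esub> b \<and> a \<otimes>\<^bsub>B\<^esub> b = b \<otimes>\<^bsub>B\<^esub> a}"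

definition Pb :: "('a, 'm) ring_scheme \<Rightarrow> real" where
  "Pb B = real (card {(a, b). a \<in> carrier B \<and> b \<in> carrier B \<and>
       star B a b = \<one>\<^bsub>B\<^esub> \<and> star B b a = \<one>\<^bsub>B\<^esub> \<and> add_commutator B a b = \<one>\<^bsub>B\<^esub>})
     / (real (card (carrier B)))\<^sup>2"

text \<open>
  The quotient by an ideal \<open>I\<close>. The cosets of an ideal with respect to \<open>\<oplus>\<close> and to \<open>\<otimes>\<close> coincide, and
  both operations on cosets are given by elementwise (complex) products, as in \<open>FactGroup\<close>.
  For \<open>I = Ann B\<close> see \<open>quotient_ops\<close> and \<open>skew_left_brace_quotient_Ann\<close>.
\<close>

definition skew_brace_quotient :: "('a, 'm) ring_scheme \<Rightarrow> 'a set \<Rightarrow> 'a set ring" where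
  "skew_brace_quotient B I =
     \<lparr>carrier = rcosets\<^bsub>add_monoid B\<^esub> I, monoid.mult = set_mult B, one = I,
      zero = I, add = set_mult (add_monoid B)\<rparr>"

definition skew_brace_iso :: "('a, 'm) ring_scheme \<Rightarrow> ('b, 'n) ring_scheme \<Rightarrow> ('a \<Rightarrow> 'b) set" where
  "skew_brace_iso B C = iso (add_monoid B) (add_monoid C) \<inter> iso B C"

definition skew_brace_isomorphic :: "('a, 'm) ring_scheme \<Rightarrow> ('b, 'n) ring_scheme \<Rightarrow> bool" where
  "skew_brace_isomorphic B C \<longleftrightarrow> skew_brace_iso B C \<noteq> {}"

definition trivial_skew_brace :: "('a, 'm) monoid_scheme \<Rightarrow> 'a ring" where
  "trivial_skew_brace G =
     \<lparr>carrier = carrier G, monoid.mult = monoid.mult G, one = monoid.one G,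
      zero = monoid.one G, add = monoid.mult G\<rparr>"

definition Z_brace :: "nat \<Rightarrow> int ring" where
  "Z_brace n = trivial_skew_brace (integer_mod_group n)"

lemma skew_left_brace_trivial:
  assumes "group G"
  shows "skew_left_brace (trivial_skew_brace G)"
proof -
  interpret group G by fact
  let ?T = "trivial_skew_brace G"
  have add: "group (add_monoid ?T)"
    by (rule groupI) (auto simp: trivial_skew_brace_def m_assoc intro: l_inv_ex)
  have mul: "group ?T"
    by (rule groupI) (auto simp: trivial_skew_brace_def m_assoc intro: l_inv_ex)
  interpret A: group "add_monoid ?T" by (rule add)
  have inv: "\<ominus>\<^bsub>?T\<^esub> a \<in> carrier G \<and> monoid.mult G (\<ominus>\<^bsub>?T\<^esub> a) a = \<one>\<^bsub>G\<^esub>" if "a \<in> carrier G" for a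
    using A.inv_closed[of a] A.l_inv[of a] that
    by (auto simp: a_inv_def trivial_skew_brace_def)
  have "a \<otimes>\<^bsub>G\<^esub> (b \<otimes>\<^bsub>G\<^esub> c) = a \<otimes>\<^bsub>G\<^esub> b \<otimes>\<^bsub>G\<^esub> (\<ominus>\<^bsub>?T\<^esub> a) \<otimes>\<^bsub>G\<^esub> (a \<otimes>\<^bsub>G\<^esub> c)"
    if "a \<in> carrier G" "b \<in> carrier G" "c \<in> carrier G" for a b c
    using inv[OF that(1)] that by (metis m_assoc m_closed r_one)
  then show ?thesis
    by (intro skew_left_brace.intro add mul) (simp add: a_minus_def, simp add: trivial_skew_brace_def)
qed

lemma skew_left_brace_Z_brace: "skew_left_brace (Z_brace n)"
  unfolding Z_brace_def by (rule skew_left_brace_trivial) simp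

context skew_left_brace
begin

sublocale A: group "add_monoid B"
  rewrites "carrier (add_monoid B) = carrier B" and "monoid.mult (add_monoid B) = add B"
    and "one (add_monoid B) = zero B" and "m_inv (add_monoid B) = a_inv B"
  by (rule add_group) (simp_all add: a_inv_def)

sublocale M: group B by (rule mult_group)

lemma zero_eq_one: "\<zero> = \<one>"
proof -
  have "\<one> \<otimes> (\<zero> \<oplus> \<zero>) = ((\<one> \<otimes> \<zero>) \<ominus> \<one>) \<oplus> (\<one> \<otimes> \<zero>)"
    by (rule skew_distrib) auto
  then have "\<zero> = \<ominus> \<one>"
    by (simp add: a_minus_def)
  then show ?thesis
    by (metis A.inv_one A.inv_inv M.one_closed)
qed

lemma Ann_D:
  assumes "z \<in> Ann B" "b \<in> carrier B"
  shows "z \<in> carrier B" "b \<oplus> z = z \<oplus> b" "z \<otimes> b = z \<oplus> b" "b \<otimes> z = z \<oplus> b"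
  using assms by (auto simp: Ann_def)

lemma Ann_add: assumes "z \<in> Ann B" "w \<in> Ann B" shows "z \<oplus> w \<in> Ann B"
proof -
  have c: "z \<in> carrier B" "w \<in> carrier B" using assms by (auto simp: Ann_def)
  have 0: "z \<otimes> w = z \<oplus> w" using Ann_D[OF assms(1) c(2)] by simp
  have "(z \<oplus> w) \<oplus> b = b \<oplus> (z \<oplus> w)" "(z \<oplus> w) \<otimes> b = z \<oplus> w \<oplus> b" "b \<otimes> (z \<oplus> w) = z \<oplus> w \<oplus> b"
    if b: "b \<in> carrier B" for b
  proof -
    note D = Ann_D[OF assms(1)] Ann_D[OF assms(2)]
    show "(z \<oplus> w) \<oplus> b = b \<oplus> (z \<oplus> w)"
      using D b c by (metis A.m_assoc)
    show 1: "(z \<oplus> w) \<otimes> b = z \<oplus> w \<oplus> b"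
      using D b c 0 by (metis A.m_assoc M.m_assoc A.m_closed)
    show "b \<otimes> (z \<oplus> w) = z \<oplus> w \<oplus> b"
      using D b c 0 1 by (metis M.m_assoc M.m_closed)
  qed
  then show ?thesis using c by (auto simp: Ann_def)
qed

lemma Ann_inv:
  assumes "z \<in> Ann B" shows "\<ominus> z \<in> Ann B" "inv z = \<ominus> z"
proof -
  have c: "z \<in> carrier B" "\<ominus> z \<in> carrier B" using assms by (auto simp: Ann_def)
  note D = Ann_D[OF assms]
  have z: "z \<otimes> \<ominus> z = \<one>" using D(3)[OF c(2)] c zero_eq_one by simp
  then show i: "inv z = \<ominus> z" using c by (metis M.inv_equality M.inv_inv)
  have "\<ominus> z \<oplus> b = b \<oplus> \<ominus> z" "\<ominus> z \<otimes> b = \<ominus> z \<oplus> b" "b \<otimes> \<ominus> z = \<ominus> z \<oplus> b"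
    if b: "b \<in> carrier B" for b
  proof -
    show "\<ominus> z \<oplus> b = b \<oplus> \<ominus> z"
      using D(2)[OF b] b c by (metis A.inv_solve_left A.inv_solve_right A.m_assoc A.m_closed)
    have "z \<otimes> (\<ominus> z \<oplus> b) = b"
      using D(3)[of "\<ominus> z \<oplus> b"] b c by (simp add: A.m_assoc[symmetric])
    then show 1: "\<ominus> z \<otimes> b = \<ominus> z \<oplus> b"
      using i b c by (metis M.inv_solve_left A.m_closed)
    have "b \<otimes> inv z = inv z \<otimes> b"
      using D(3,4)[OF b] b c by (metis M.inv_solve_left M.inv_solve_right M.m_assoc M.m_closed M.inv_closed)
    then show "b \<otimes> \<ominus> z = \<ominus> z \<oplus> b" using i 1 by simp
  qed
  then show "\<ominus> z \<in> Ann B" using c by (auto simp: Ann_def)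
qed

lemma Ann_subset: "Ann B \<subseteq> carrier B"
  by (auto simp: Ann_def)

lemma zero_in_Ann: "\<zero> \<in> Ann B"
  by (auto simp: Ann_def) (auto simp: zero_eq_one)

lemma rcos_Ann_eq: "a \<in> carrier B \<Longrightarrow> Ann B #> a = Ann B #>\<^bsub>add_monoid B\<^esub> a"
  using Ann_D(3) by (auto simp: r_coset_def)

lemma normal_Ann_add: "Ann B \<lhd> add_monoid B"
proof -
  have s: "subgroup (Ann B) (add_monoid B)"
    using Ann_subset Ann_add Ann_inv(1) zero_in_Ann by unfold_locales (auto simp: a_inv_def)
  show ?thesis
    by (rule group.normal_invI[OF add_group s])
       (metis A.inv_solve_right A.inv_closed A.m_closed Ann_D(1,2) a_inv_def monoid.simps(1) partial_object.simps(1))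
qed

lemma normal_Ann_mult: "Ann B \<lhd> B"
proof -
  have s: "subgroup (Ann B) B"
    using Ann_subset Ann_add Ann_inv zero_in_Ann Ann_D(3) by unfold_locales (auto simp: zero_eq_one)
  show ?thesis
    by (rule group.normal_invI[OF mult_group s])
       (metis M.inv_solve_right M.m_closed Ann_D(1,3,4))
qed

lemma quotient_ops:
  assumes "a \<in> carrier B" "b \<in> carrier B"
  defines "Q \<equiv> skew_brace_quotient B (Ann B)"
  shows "(Ann B #>\<^bsub>add_monoid B\<^esub> a) \<oplus>\<^bsub>Q\<^esub> (Ann B #>\<^bsub>add_monoid B\<^esub> b) = Ann B #>\<^bsub>add_monoid B\<^esub> (a \<oplus> b)"
    and "(Ann B #>\<^bsub>add_monoid B\<^esub> a) \<otimes>\<^bsub>Q\<^esub> (Ann B #>\<^bsub>add_monoid B\<^esub> b) = Ann B #>\<^bsub>add_monoid B\<^esub> (a \<otimes> b)"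
  using normal.rcos_sum[OF normal_Ann_add, of a b] normal.rcos_sum[OF normal_Ann_mult, of a b] assms
  by (simp_all add: skew_brace_quotient_def rcos_Ann_eq)

lemma skew_left_brace_quotient_Ann: "skew_left_brace (skew_brace_quotient B (Ann B))"
proof -
  define Q where "Q = skew_brace_quotient B (Ann B)"
  have rc: "rcosets\<^bsub>add_monoid B\<^esub> (Ann B) = rcosets (Ann B)"
    by (auto simp: RCOSETS_def rcos_Ann_eq)
  have "add_monoid Q = add_monoid B Mod Ann B"
    by (simp add: Q_def skew_brace_quotient_def FactGroup_def)
  then have ag: "group (add_monoid Q)"
    using normal.factorgroup_is_group[OF normal_Ann_add] by simp
  have "group (B Mod Ann B)"
    by (rule normal.factorgroup_is_group[OF normal_Ann_mult])
  then have mg: "group Q"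
    by (simp add: group_def monoid_def group_axioms_def Units_def Q_def
        skew_brace_quotient_def FactGroup_def rc)
  let ?c = "\<lambda>a. Ann B #>\<^bsub>add_monoid B\<^esub> a"
  have ops: "?c a \<oplus>\<^bsub>Q\<^esub> ?c b = ?c (a \<oplus> b)" "?c a \<otimes>\<^bsub>Q\<^esub> ?c b = ?c (a \<otimes> b)"
    if "a \<in> carrier B" "b \<in> carrier B" for a b
    using quotient_ops[OF that] by (simp_all add: Q_def)
  have car: "carrier Q = ?c ` carrier B"
    by (auto simp: Q_def skew_brace_quotient_def RCOSETS_def)
  interpret q: group "add_monoid Q" by (rule ag)
  have z: "?c \<zero> = \<zero>\<^bsub>Q\<^esub>"
    using normal_Ann_add group.coset_mult_one[OF add_group, of "Ann B"] Ann_subset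
    by (simp add: Q_def skew_brace_quotient_def)
  have neg: "\<ominus>\<^bsub>Q\<^esub> (?c a) = ?c (\<ominus> a)" if "a \<in> carrier B" for a
    using q.inv_equality[of "?c (\<ominus> a)" "?c a"] that ops(1)[of "\<ominus> a" a] z
    by (simp add: a_inv_def[of Q] car)
  show ?thesis
    unfolding Q_def[symmetric]
  proof (rule skew_left_brace.intro[OF ag mg])
    fix x y w assume "x \<in> carrier Q" "y \<in> carrier Q" "w \<in> carrier Q"
    then obtain a b c where "x = ?c a" "y = ?c b" "w = ?c c"
      and m: "a \<in> carrier B" "b \<in> carrier B" "c \<in> carrier B" unfolding car by blast
    then show "x \<otimes>\<^bsub>Q\<^esub> (y \<oplus>\<^bsub>Q\<^esub> w) = ((x \<otimes>\<^bsub>Q\<^esub> y) \<ominus>\<^bsub>Q\<^esub> x) \<oplus>\<^bsub>Q\<^esub> (x \<otimes>\<^bsub>Q\<^esub> w)"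
      using skew_distrib[OF m] by (simp add: a_minus_def neg ops)
  qed
qed

end

end

theory Submission
  imports Defs "HOL-Algebra.Multiplicative_Group"
begin

text \<open>
  The commuting probability counts the pairs \<open>(a, b)\<close> with \<open>b\<close> in the centraliser
  \<open>C(a) = {b. a \<circ> b = b \<circ> a = a + b = b + a}\<close>. The key fact is that \<open>C(a)\<close>, although defined through
  both operations, is a subgroup of \<open>(B, \<circ>)\<close> (\<open>subgroup_brace_centralizer\<close>), and it is all of \<open>B\<close>
  exactly when \<open>a \<in> Ann(B)\<close>. Write \<open>m = |B|\<close> and \<open>z = |Ann(B)|\<close>. When \<open>p\<close> is the smallest prime
  dividing \<open>m\<close>, every proper centraliser has at most \<open>m / p\<close> elements by Lagrange, so that the number
  of commuting pairs is at most \<open>z m + (m - z) m / p\<close> (\<open>card_commuting_pairs_le\<close>). If this number is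
  \<open>(2 p - 1) m\<^sup>2 / p\<^sup>2\<close>, the bound rearranges to \<open>m \<le> p z\<close>. On the other hand \<open>Ann(B)\<close> is itself
  a proper subgroup, so \<open>p z \<le> m\<close>. Hence \<open>B / Ann(B)\<close> has order exactly \<open>p\<close>.

  A skew brace \<open>Q\<close> of prime order is trivial (\<open>mult_eq_add_of_prime_order\<close>): \<open>(Q, \<circ>)\<close> acts on the
  set \<open>Q\<close> by \<open>\<lambda>\<^sub>a(c) = -a + a \<circ> c\<close>, its orbits have size 1 or \<open>p\<close>, and since \<open>0\<close> is a fixed
  point there is no room for an orbit of size \<open>p\<close>. Thus \<open>a \<circ> c = a + c\<close>, and an isomorphism of
  the additive group with the integers modulo \<open>p\<close> is an isomorphism of skew braces.

  The divisibility \<open>p dvd m\<close> is pure arithmetic: \<open>p\<^sup>2\<close> times the number of commuting pairs is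
  \<open>(2 p - 1) m\<^sup>2\<close>, and \<open>p\<close> is coprime to \<open>2 p - 1\<close>.
\<close>

section \<open>Subgroups of finite groups and groups of prime order\<close>

lemma (in group) smallest_prime_times_card_proper_subgroup_le:
  fixes p :: nat
  assumes fin: "finite (carrier G)" and H: "subgroup H G" "H \<noteq> carrier G"
    and min: "\<And>q::nat. prime q \<Longrightarrow> q dvd order G \<Longrightarrow> p \<le> q"
  shows "p * card H \<le> order G"
proof -
  have lag: "card (rcosets H) * card H = order G"
    by (rule lagrange[OF H(1)])
  have pos: "order G > 0"
    using fin by (simp add: order_gt_0_iff_finite)
  have "card H \<noteq> order G"
    using H fin card_subset_eq[OF fin] subgroup.subset[OF H(1)] by (auto simp: order_def)
  then have "card (rcosets H) \<noteq> 1"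
    using lag by auto
  then obtain q :: nat where q: "prime q" "q dvd card (rcosets H)"
    using prime_factor_nat by blast
  have "p \<le> q"
    using min[OF q(1)] q(2) lag by (metis dvd_mult2)
  also have "q \<le> card (rcosets H)"
    using q(2) lag pos by (intro dvd_imp_le) (auto intro: Nat.gr0I)
  finally show ?thesis
    using lag by (metis mult_le_mono1)
qed

lemma (in group) integer_mod_group_iso_of_prime_order:
  assumes p: "prime (order G)"
  shows "integer_mod_group (order G) \<cong> G"
proof -
  let ?p = "order G"
  have p1: "?p > 1"
    using p prime_gt_1_nat by blast
  then have fin: "finite (carrier G)"
    by (simp add: order_gt_0_iff_finite[symmetric])
  have "carrier G \<noteq> {\<one>}"
    using p1 by (auto simp: order_def)
  then obtain g where g: "g \<in> carrier G" "g \<noteq> \<one>"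
    using one_closed by blast
  have ord: "ord g = ?p"
    using ord_dvd_group_order[OF g(1)] ord_eq_1[OF g(1)] g(2) p by (auto simp: prime_nat_iff)
  let ?Z = "integer_mod_group ?p" and ?h = "\<lambda>i::int. g [^] i"
  have car: "carrier ?Z = {0..<int ?p}"
    using p1 by (simp add: carrier_integer_mod_group)
  have inj: "inj_on ?h (carrier ?Z)"
  proof (rule inj_onI)
    fix i j assume ij: "i \<in> carrier ?Z" "j \<in> carrier ?Z" "g [^] i = g [^] j"
    then have "int ?p dvd (j - i)"
      using int_pow_eq[OF g(1)] ord by simp
    then show "i = j"
      using ij(1,2) unfolding car by (metis mod_eq_dvd_iff mod_pos_pos_trivial atLeastLessThan_iff)
  qed
  have sub: "?h ` carrier ?Z \<subseteq> carrier G"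
    using g by auto
  have "card (?h ` carrier ?Z) = card (carrier G)"
    using card_image[OF inj] car by (simp add: order_def)
  then have "?h ` carrier ?Z = carrier G"
    using sub fin by (metis card_subset_eq)
  moreover have "g [^] ((i + j) mod int ?p) = g [^] i \<otimes> g [^] j" for i j :: int
  proof -
    have "g [^] ((i + j) mod int ?p) = g [^] (i + j)"
      using int_pow_eq[OF g(1)] ord by (simp add: mod_eq_dvd_iff[symmetric])
    then show ?thesis
      by (simp add: int_pow_mult g)
  qed
  ultimately have "?h \<in> iso ?Z G"
    using inj sub by (auto simp: iso_def bij_betw_def hom_def)
  then show ?thesis
    by (auto simp: is_iso_def)
qed

section \<open>Centralisers in a skew brace and commuting pairs\<close>

context skew_left_brace
begin

lemma add_minus_cancel_left:
  "\<lbrakk>a \<in> carrier B; b \<in> carrier B\<rbrakk> \<Longrightarrow> a \<oplus> (\<ominus> a \<oplus> b) = b"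
  "\<lbrakk>a \<in> carrier B; b \<in> carrier B\<rbrakk> \<Longrightarrow> \<ominus> a \<oplus> (a \<oplus> b) = b"
  by (simp_all add: A.m_assoc[symmetric])

text \<open>
  The brace identity in the form \<open>a \<circ> (b + c) = a \<circ> b + \<lambda>\<^sub>a(c)\<close> with \<open>\<lambda>\<^sub>a(c) = -a + a \<circ> c\<close>.
\<close>

lemma mult_add:
  assumes "a \<in> carrier B" "b \<in> carrier B" "c \<in> carrier B"
  shows "a \<otimes> (b \<oplus> c) = a \<otimes> b \<oplus> (\<ominus> a \<oplus> a \<otimes> c)"
  using skew_distrib[OF assms] assms by (simp add: a_minus_def A.m_assoc)

definition brace_centralizer :: "'a \<Rightarrow> 'a set" where
  "brace_centralizer a =
     {b \<in> carrier B. a \<otimes> b = a \<oplus> b \<and> b \<otimes> a = a \<oplus> b \<and> b \<oplus> a = a \<oplus> b}"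

text \<open>
  With \<open>b \<circ> a = b + a = a + b\<close>, the correction term \<open>-b\<close> in the brace identity cancels, so that \<open>b\<close>
  distributes over sums with \<open>a\<close> as if \<open>a\<close> were left alone.
\<close>

lemma brace_centralizer_mult_add:
  assumes a: "a \<in> carrier B" and b: "b \<in> brace_centralizer a" and c: "c \<in> carrier B"
  shows "b \<otimes> (c \<oplus> a) = b \<otimes> c \<oplus> a" "b \<otimes> (a \<oplus> c) = a \<oplus> b \<otimes> c"
proof -
  have b': "b \<in> carrier B" "b \<otimes> a = a \<oplus> b" "b \<oplus> a = a \<oplus> b"
    using b by (auto simp: brace_centralizer_def)
  show "b \<otimes> (c \<oplus> a) = b \<otimes> c \<oplus> a"
    using mult_add[OF b'(1) c a] a b' by (metis add_minus_cancel_left(2))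
  show "b \<otimes> (a \<oplus> c) = a \<oplus> b \<otimes> c"
    using mult_add[OF b'(1) a c] a b' c by (simp add: A.m_assoc add_minus_cancel_left)
qed

text \<open>
  Apply the two distributive laws to \<open>b\<close> in the centraliser. If \<open>c\<close> is another element of the
  centraliser, they show that both \<open>(b \<circ> c) \<circ> a = b \<circ> (c + a)\<close> and
  \<open>a \<circ> (b \<circ> c) = b \<circ> (a + c)\<close> are sums of \<open>b \<circ> c\<close> and \<open>a\<close>, in either order. If \<open>c\<close> is the
  inverse of \<open>b\<close> in \<open>(B, \<circ>)\<close>, they say \<open>b \<circ> (c + a) = a = b \<circ> (a + c)\<close>, hence
  \<open>c + a = c \<circ> a = a + c\<close>.
\<close>

lemma subgroup_brace_centralizer:
  assumes a: "a \<in> carrier B"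
  shows "subgroup (brace_centralizer a) B"
proof (rule M.subgroupI)
  show "brace_centralizer a \<subseteq> carrier B"
    by (auto simp: brace_centralizer_def)
  have "\<one> \<oplus> a = a" "a \<oplus> \<one> = a"
    using a by (simp_all add: zero_eq_one[symmetric])
  then have "\<one> \<in> brace_centralizer a"
    using a by (simp add: brace_centralizer_def)
  then show "brace_centralizer a \<noteq> {}"
    by blast
next
  fix b assume bC: "b \<in> brace_centralizer a"
  then have b: "b \<in> carrier B" "a \<otimes> b = a \<oplus> b" "b \<otimes> a = a \<oplus> b"
    by (auto simp: brace_centralizer_def)
  let ?c = "inv b"
  have c: "?c \<in> carrier B"
    using b by simp
  have "b \<otimes> (?c \<oplus> a) = \<one> \<oplus> a" "b \<otimes> (a \<oplus> ?c) = a \<oplus> \<one>"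
    using brace_centralizer_mult_add[OF a bC c] b(1) by simp_all
  then have "b \<otimes> (?c \<oplus> a) = a" "b \<otimes> (a \<oplus> ?c) = a"
    using a by (simp_all add: zero_eq_one[symmetric])
  then have "?c \<oplus> a = ?c \<otimes> a" "a \<oplus> ?c = ?c \<otimes> a"
    using a b(1) c by (metis A.m_closed M.inv_solve_left)+
  moreover have "a \<otimes> ?c = ?c \<otimes> a"
    using a b by (metis M.inv_solve_left M.inv_solve_right M.m_assoc M.m_closed M.inv_closed)
  ultimately show "?c \<in> brace_centralizer a"
    using c by (simp add: brace_centralizer_def)
next
  fix b c assume bC: "b \<in> brace_centralizer a" and "c \<in> brace_centralizer a"
  then have b: "b \<in> carrier B" "a \<otimes> b = a \<oplus> b" "b \<otimes> a = a \<oplus> b"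
    and c: "c \<in> carrier B" "a \<otimes> c = a \<oplus> c" "c \<otimes> a = a \<oplus> c" "c \<oplus> a = a \<oplus> c"
    by (auto simp: brace_centralizer_def)
  have "a \<otimes> (b \<otimes> c) = b \<otimes> (a \<oplus> c)"
    using a b c by (metis M.m_assoc)
  moreover have "(b \<otimes> c) \<otimes> a = b \<otimes> (a \<oplus> c)"
    using a b c by (simp add: M.m_assoc)
  ultimately show "b \<otimes> c \<in> brace_centralizer a"
    using brace_centralizer_mult_add[OF a bC c(1)] b(1) c by (simp add: brace_centralizer_def)
qed

lemma brace_centralizer_eq_carrier_iff:
  assumes "a \<in> carrier B"
  shows "brace_centralizer a = carrier B \<longleftrightarrow> a \<in> Ann B"
proof -
  have "brace_centralizer a = carrier B \<longleftrightarrow>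
      (\<forall>b\<in>carrier B. a \<otimes> b = a \<oplus> b \<and> b \<otimes> a = a \<oplus> b \<and> b \<oplus> a = a \<oplus> b)"
    unfolding brace_centralizer_def by blast
  also have "\<dots> \<longleftrightarrow> a \<in> Ann B"
    using assms unfolding Ann_def mem_Collect_eq by metis
  finally show ?thesis .
qed

definition commuting_pairs :: "('a \<times> 'a) set" where
  "commuting_pairs = (SIGMA a:carrier B. brace_centralizer a)"

lemma Pb_eq: "Pb B = real (card commuting_pairs) / (real (card (carrier B)))\<^sup>2"
proof -
  have star: "star B a b = \<one> \<longleftrightarrow> a \<otimes> b = a \<oplus> b" if "a \<in> carrier B" "b \<in> carrier B" for a b
    using that unfolding star_def a_minus_def zero_eq_one[symmetric]
    by (metis A.inv_closed A.inv_equality A.inv_inv A.m_closed A.r_inv M.m_closed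
        add_minus_cancel_left)
  have comm: "add_commutator B a b = \<one> \<longleftrightarrow> b \<oplus> a = a \<oplus> b" if "a \<in> carrier B" "b \<in> carrier B" for a b
  proof -
    have "\<zero> = a \<oplus> b \<oplus> \<ominus> a \<oplus> \<ominus> b \<longleftrightarrow> a \<oplus> b \<oplus> \<ominus> a = b"
      using that A.inv_solve_right[of \<zero> "a \<oplus> b \<oplus> \<ominus> a" b] by simp
    moreover have "b = a \<oplus> b \<oplus> \<ominus> a \<longleftrightarrow> a \<oplus> b = b \<oplus> a"
      using that by (intro A.inv_solve_right) auto
    ultimately show ?thesis
      unfolding add_commutator_def a_minus_def zero_eq_one[symmetric] by metis
  qed
  have "{(a, b). a \<in> carrier B \<and> b \<in> carrier B \<and> star B a b = \<one> \<and> star B b a = \<one>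
      \<and> add_commutator B a b = \<one>} = commuting_pairs"
    by (auto simp: star comm commuting_pairs_def brace_centralizer_def)
  then show ?thesis
    by (simp add: Pb_def)
qed

text \<open>
  Elements of the annihilator contribute \<open>m\<close> pairs each, all others at most \<open>m / p\<close>. The bound is
  multiplied by \<open>p\<close> to stay within the natural numbers.
\<close>

lemma card_commuting_pairs_le:
  fixes p :: nat
  assumes fin: "finite (carrier B)" and p: "p > 0"
    and min: "\<And>q::nat. prime q \<Longrightarrow> q dvd card (carrier B) \<Longrightarrow> p \<le> q"
  shows "p * card commuting_pairs
    \<le> card (carrier B) * (card (carrier B) + (p - 1) * card (Ann B))"
proof -
  let ?m = "card (carrier B)"
  have bound: "p * card (brace_centralizer a) \<le> ?m + (if a \<in> Ann B then (p - 1) * ?m else 0)"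
    if a: "a \<in> carrier B" for a
  proof (cases "a \<in> Ann B")
    case True
    then show ?thesis
      using brace_centralizer_eq_carrier_iff[OF a] p by (cases p) auto
  next
    case False
    then show ?thesis
      using M.smallest_prime_times_card_proper_subgroup_le[OF fin subgroup_brace_centralizer[OF a], of p]
        brace_centralizer_eq_carrier_iff[OF a] min by (simp add: order_def)
  qed
  have "card commuting_pairs = (\<Sum>a\<in>carrier B. card (brace_centralizer a))"
    unfolding commuting_pairs_def
    using fin by (intro card_SigmaI) (auto simp: brace_centralizer_def)
  then have "p * card commuting_pairs = (\<Sum>a\<in>carrier B. p * card (brace_centralizer a))"
    by (simp add: sum_distrib_left)
  also have "\<dots> \<le> (\<Sum>a\<in>carrier B. ?m + (if a \<in> Ann B then (p - 1) * ?m else 0))"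
    by (intro sum_mono bound)
  also have "\<dots> = ?m * ?m + (\<Sum>a\<in>Ann B. (p - 1) * ?m)"
    using fin Ann_subset by (simp add: sum.distrib sum.If_cases Int_absorb1)
  also have "\<dots> = ?m * (?m + (p - 1) * card (Ann B))"
    by (simp add: algebra_simps)
  finally show ?thesis .
qed

section \<open>Skew braces of prime order\<close>

text \<open>
  The set below is the stabiliser of \<open>c\<close> under the action \<open>\<lambda>\<^sub>a(c) = -a + a \<circ> c\<close> of \<open>(B, \<circ>)\<close>.
\<close>

lemma subgroup_stabilizer:
  assumes c: "c \<in> carrier B"
  shows "subgroup {a \<in> carrier B. a \<otimes> c = a \<oplus> c} B"
proof (rule M.subgroupI)
  have "\<one> \<otimes> c = \<one> \<oplus> c"
    using c zero_eq_one by (metis A.l_one M.l_one)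
  then show "{a \<in> carrier B. a \<otimes> c = a \<oplus> c} \<noteq> {}"
    by blast
next
  fix a assume "a \<in> {a \<in> carrier B. a \<otimes> c = a \<oplus> c}"
  then have a: "a \<in> carrier B" "a \<otimes> c = a \<oplus> c"
    by auto
  have "inv a \<otimes> (a \<oplus> c) = c"
    using a c by (metis M.inv_closed M.l_inv M.l_one M.m_assoc)
  then have "\<ominus> (inv a) \<oplus> inv a \<otimes> c = c"
    using mult_add[of "inv a" a c] a(1) c by (simp add: zero_eq_one[symmetric])
  then show "inv a \<in> {a \<in> carrier B. a \<otimes> c = a \<oplus> c}"
    using a(1) c add_minus_cancel_left(1)[of "inv a" "inv a \<otimes> c"] by simp
next
  fix a b assume "a \<in> {a \<in> carrier B. a \<otimes> c = a \<oplus> c}" "b \<in> {a \<in> carrier B. a \<otimes> c = a \<oplus> c}"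
  then have a: "a \<in> carrier B" "a \<otimes> c = a \<oplus> c" and b: "b \<in> carrier B" "b \<otimes> c = b \<oplus> c"
    by auto
  then show "a \<otimes> b \<in> {a \<in> carrier B. a \<otimes> c = a \<oplus> c}"
    using c by (simp add: M.m_assoc mult_add add_minus_cancel_left)
qed auto

lemma mult_eq_add_of_prime_order:
  assumes p: "prime (card (carrier B))" and x: "x \<in> carrier B" and c: "c \<in> carrier B"
  shows "x \<otimes> c = x \<oplus> c"
proof (cases "c = \<zero>")
  case True
  then show ?thesis
    using x zero_eq_one by (metis A.r_one M.r_one)
next
  case False
  have fin: "finite (carrier B)"
    using p by (intro card_ge_0_finite prime_gt_0_nat)
  let ?S = "{a \<in> carrier B. a \<otimes> c = a \<oplus> c}"
  let ?f = "\<lambda>a. \<ominus> a \<oplus> a \<otimes> c"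
  \<comment> \<open>The orbit of \<open>c \<noteq> 0\<close> misses \<open>0\<close>, so the orbit map is not injective on the \<open>p\<close> elements.\<close>
  have "\<zero> \<notin> ?f ` carrier B"
  proof
    assume "\<zero> \<in> ?f ` carrier B"
    then obtain a where "\<zero> = ?f a" and a: "a \<in> carrier B"
      by (rule imageE)
    then have "a \<otimes> c = a"
      using a c by (metis A.r_one M.m_closed add_minus_cancel_left(1))
    then show False
      using False a c by (simp add: zero_eq_one)
  qed
  then have "?f ` carrier B \<noteq> carrier B"
    using A.one_closed by blast
  moreover have "?f ` carrier B \<subseteq> carrier B"
    using c by auto
  ultimately have "\<not> inj_on ?f (carrier B)"
    using endo_inj_surj[OF fin, of ?f] by blast
  then obtain a b where ab: "a \<in> carrier B" "b \<in> carrier B" "a \<noteq> b" "?f a = ?f b"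
    unfolding inj_on_def by blast
  \<comment> \<open>Two elements moving \<open>c\<close> to the same place differ by a nontrivial element of the stabiliser.\<close>
  let ?u = "inv a \<otimes> b"
  have u: "?u \<in> carrier B" "a \<otimes> ?u = b"
    using ab by (simp_all add: M.m_assoc[symmetric])
  have "a \<otimes> (?u \<oplus> c) = b \<oplus> ?f a"
    using mult_add[OF ab(1) u(1) c] u(2) by simp
  also have "\<dots> = b \<otimes> c"
    using ab c by (simp add: add_minus_cancel_left)
  also have "\<dots> = a \<otimes> (?u \<otimes> c)"
    using ab(1) u c by (simp add: M.m_assoc[symmetric])
  finally have "?u \<in> ?S"
    using ab(1) u(1) c by simp
  moreover have "?u \<noteq> \<one>"
    using u(2) ab by auto
  moreover have "\<one> \<in> ?S"
    using subgroup.one_closed[OF subgroup_stabilizer[OF c]] .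
  ultimately have "card ?S \<noteq> 1"
    by (metis card_1_singletonE singletonD)
  moreover have "card ?S dvd card (carrier B)"
    by (rule dvdI[of _ _ "card (rcosets ?S)"])
      (use M.lagrange[OF subgroup_stabilizer[OF c]] in \<open>simp add: order_def mult.commute\<close>)
  ultimately have "card ?S = card (carrier B)"
    using p by (auto simp: prime_nat_iff)
  then have "?S = carrier B"
    using fin by (intro card_subset_eq) auto
  then show ?thesis
    using x by blast
qed

lemma isomorphic_Z_brace_of_prime_order:
  assumes p: "prime (card (carrier B))"
  shows "skew_brace_isomorphic B (Z_brace (card (carrier B)))"
proof -
  let ?p = "card (carrier B)"
  have "integer_mod_group ?p \<cong> add_monoid B"
    using group.integer_mod_group_iso_of_prime_order[OF add_group] p by (simp add: order_def)
  then have "add_monoid B \<cong> integer_mod_group ?p"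
    using group.iso_sym[OF group_integer_mod_group] by blast
  then obtain h where h: "h \<in> iso (add_monoid B) (integer_mod_group ?p)"
    by (auto simp: is_iso_def)
  then have "h \<in> skew_brace_iso B (Z_brace ?p)"
    using mult_eq_add_of_prime_order[OF p]
    by (simp add: skew_brace_iso_def iso_def hom_def Z_brace_def trivial_skew_brace_def)
  then show ?thesis
    by (auto simp: skew_brace_isomorphic_def)
qed

end

section \<open>The value of the commuting probability\<close>

lemma prime_dvd_of_square_mult_eq:
  fixes p m n :: nat
  assumes p: "prime p" and eq: "p\<^sup>2 * n = (2 * p - 1) * m\<^sup>2"
  shows "p dvd m"
proof -
  have "p dvd p\<^sup>2 * n"
    by (simp add: power2_eq_square)
  then have "p dvd (2 * p - 1) * m\<^sup>2"
    by (simp only: eq)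
  moreover have "\<not> p dvd 2 * p - 1"
  proof
    assume "p dvd 2 * p - 1"
    from dvd_add_right_iff[OF this, of 1] have "p dvd 1"
      using prime_gt_0_nat[OF p] by simp
    then show False
      using p by (metis not_prime_unit)
  qed
  ultimately show ?thesis
    using prime_dvd_multD[OF p] prime_dvd_power[OF p] by blast
qed

text \<open>
  Multiplying the bound \<open>p n \<le> m (m + (p - 1) z)\<close> by \<open>p\<close> and substituting the value of \<open>p\<^sup>2 n\<close>
  leaves \<open>(p - 1) m \<le> (p - 1) p z\<close> after cancelling \<open>m\<close>.
\<close>

lemma le_mult_of_commuting_bound:
  fixes p m n z :: nat
  assumes p: "p > 1" and m: "m > 0"
    and eq: "p\<^sup>2 * n = (2 * p - 1) * m\<^sup>2"
    and le: "p * n \<le> m * (m + (p - 1) * z)"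
  shows "m \<le> p * z"
proof -
  obtain k where k: "p = Suc k" "k > 0"
    using p by (cases p) auto
  have "m * ((2 * p - 1) * m) = p * (p * n)"
    using eq by (simp add: power2_eq_square algebra_simps)
  also have "\<dots> \<le> p * (m * (m + (p - 1) * z))"
    using le by (rule mult_le_mono2)
  also have "\<dots> = m * (p * (m + (p - 1) * z))"
    by simp
  finally have "(2 * p - 1) * m \<le> p * (m + (p - 1) * z)"
    using m by (simp only: mult_le_cancel1)
  then have "k * m \<le> k * (p * z)"
    using k by (simp add: algebra_simps)
  then show ?thesis
    using k by simp
qed

theorem proposition3p5:
  fixes B :: "('a, 'm) ring_scheme" and p :: nat
  assumes "skew_left_brace B"
    and "finite (carrier B)"
    and "carrier B \<noteq> Ann B"
    and "prime p"
    and "Pb B = (2 * real p - 1) / (real p)\<^sup>2"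
  shows "p dvd card (carrier B) \<and>
    ((\<forall>q::nat. prime q \<and> q dvd card (carrier B) \<longrightarrow> p \<le> q) \<longrightarrow>
      skew_brace_isomorphic (skew_brace_quotient B (Ann B)) (Z_brace p))"
proof -
  interpret skew_left_brace B by fact
  let ?m = "card (carrier B)" and ?n = "card commuting_pairs" and ?z = "card (Ann B)"
  have p: "p > 1"
    using assms(4) prime_gt_1_nat by blast
  have m: "?m > 0"
    using assms(2) M.order_gt_0_iff_finite by (simp add: order_def)
  have "(real p)\<^sup>2 * real ?n = (2 * real p - 1) * (real ?m)\<^sup>2"
    using assms(5) p m unfolding Pb_eq by (simp add: field_simps)
  moreover have "real (2 * p - 1) = 2 * real p - 1"
    using p by (simp add: of_nat_diff)
  ultimately have "real (p\<^sup>2 * ?n) = real ((2 * p - 1) * ?m\<^sup>2)"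
    by (simp only: of_nat_mult of_nat_power)
  then have eq: "p\<^sup>2 * ?n = (2 * p - 1) * ?m\<^sup>2"
    by (simp only: of_nat_eq_iff)
  have "skew_brace_isomorphic (skew_brace_quotient B (Ann B)) (Z_brace p)"
    if min: "\<And>q::nat. prime q \<Longrightarrow> q dvd ?m \<Longrightarrow> p \<le> q"
  proof -
    let ?Q = "skew_brace_quotient B (Ann B)"
    have sub: "subgroup (Ann B) B" "subgroup (Ann B) (add_monoid B)"
      using normal_Ann_mult normal_Ann_add by (simp_all add: normal_imp_subgroup)
    have "?m \<le> p * ?z"
      using le_mult_of_commuting_bound[OF p m eq] card_commuting_pairs_le[OF assms(2) _ min] p by simp
    moreover have "p * ?z \<le> ?m"
      using M.smallest_prime_times_card_proper_subgroup_le[OF assms(2) sub(1), of p] assms(3) min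
      by (auto simp: order_def)
    ultimately have "?m = p * ?z"
      by simp
    moreover have "card (rcosets\<^bsub>add_monoid B\<^esub> (Ann B)) * ?z = ?m"
      using group.lagrange[OF add_group sub(2)] by (simp add: order_def)
    ultimately have "card (rcosets\<^bsub>add_monoid B\<^esub> (Ann B)) = p"
      using m by (metis mult_cancel2 mult_0_right less_not_refl)
    then have "card (carrier ?Q) = p"
      by (simp add: skew_brace_quotient_def)
    then show ?thesis
      using skew_left_brace.isomorphic_Z_brace_of_prime_order[OF skew_left_brace_quotient_Ann] assms(4)
      by simp
  qed
  then show ?thesis
    using prime_dvd_of_square_mult_eq[OF assms(4) eq] by blast
qed

end
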